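(* Let $A=\{A_1,\dots,A_k\}\subset S^{n-1}$ be a finite set of points on the unit sphere in $\mathbb R^n$. Suppose that this set is not contained in a hyperplane. Denote by $\operatorname{Conv}(A)$ the convex hull of $A\subset\mathbb R^n$. Then the Voronoi diagram $\operatorname{VD}(A)\subset S^{n-1}$ is dual to $\operatorname{Conv}(A)$: its vertices are unit outer normals to the facets of $\operatorname{Conv}(A)$, etc. In particular, the combinatorial type of $\operatorname{VD}(A)$ is determined by the combinatorial type of $\operatorname{Conv}(A)$.
   Context: For a finite subset $A=\{A_1,\dots,A_k\}$ of the unit sphere $S^{n-1}$ with its standard metric, the Voronoi diagram $\operatorname{VD}(A)\subset S^{n-1}$ is the set of points of $S^{n-1}$ for which the nearest point of $A$ is not unique. It divides $S^{n-1}$ into the Voronoi domains $U_1,\dots,U_k$, where $U_i$ consists of the points that are closer to $A_i$ than to $A_j$ for any $j\ne i$. A facet of a convex polytope is a face of codimension 1. *)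

theory Defs
  imports "HOL-Analysis.Analysis"
begin

(* Geodesic distance; meaningful only for unit vectors x and y. *)
definition sphere_dist :: "'a::euclidean_space \<Rightarrow> 'a \<Rightarrow> real" where
  "sphere_dist x y = arccos (x \<bullet> y)"

definition voronoi_diagram :: "'a::euclidean_space set \<Rightarrow> 'a set" where
  "voronoi_diagram A =
     {x \<in> sphere 0 1. \<not> (\<exists>!a. a \<in> A \<and> (\<forall>b\<in>A. sphere_dist x a \<le> sphere_dist x b))}"

definition voronoi_domain :: "'a::euclidean_space set \<Rightarrow> 'a \<Rightarrow> 'a set" where
  "voronoi_domain A a =
     {x \<in> sphere 0 1. \<forall>b\<in>A - {a}. sphere_dist x a < sphere_dist x b}"

(* The closed cells of the subdivision of the sphere cut out by the Voronoi diagram: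
   the closed domains together with all their nonempty intersections. *)
definition voronoi_cells :: "'a::euclidean_space set \<Rightarrow> 'a set set" where
  "voronoi_cells A =
     {C. C \<noteq> {} \<and> (\<exists>B. B \<noteq> {} \<and> B \<subseteq> A \<and> C = (\<Inter>a\<in>B. closure (voronoi_domain A a)))}"

definition voronoi_diagram_faces :: "'a::euclidean_space set \<Rightarrow> 'a set set" where
  "voronoi_diagram_faces A = {C \<in> voronoi_cells A. C \<subseteq> voronoi_diagram A}"

definition voronoi_vertices :: "'a::euclidean_space set \<Rightarrow> 'a set" where
  "voronoi_vertices A = {v. {v} \<in> voronoi_diagram_faces A}"

(* Dimension of the intersection of the unit sphere with a convex cone: that of the
   smallest great subsphere containing it. *)
definition spherical_dim :: "'a::euclidean_space set \<Rightarrow> int" where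
  "spherical_dim C = int (dim C) - 1"

definition proper_faces :: "'a::euclidean_space set \<Rightarrow> 'a set set" where
  "proper_faces P = {F. F face_of P \<and> F \<noteq> {} \<and> F \<noteq> P}"

(* Unit outer normals of the supporting hyperplanes of P that contain F. If P has full
   dimension and F is a facet, this is the singleton of the unit outer normal to F. *)
definition outer_unit_normals :: "'a::euclidean_space set \<Rightarrow> 'a set \<Rightarrow> 'a set" where
  "outer_unit_normals P F =
     {u. norm u = 1 \<and> (\<exists>c. P \<subseteq> {x. u \<bullet> x \<le> c} \<and> F \<subseteq> {x. u \<bullet> x = c})}"

definition inclusion_isomorphism :: "('a set \<Rightarrow> 'b set) \<Rightarrow> 'a set set \<Rightarrow> 'b set set \<Rightarrow> bool" where
  "inclusion_isomorphism f X Y \<longleftrightarrow>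
     bij_betw f X Y \<and> (\<forall>F\<in>X. \<forall>G\<in>X. f F \<subseteq> f G \<longleftrightarrow> F \<subseteq> G)"

definition inclusion_antiisomorphism :: "('a set \<Rightarrow> 'b set) \<Rightarrow> 'a set set \<Rightarrow> 'b set set \<Rightarrow> bool" where
  "inclusion_antiisomorphism f X Y \<longleftrightarrow>
     bij_betw f X Y \<and> (\<forall>F\<in>X. \<forall>G\<in>X. f F \<subseteq> f G \<longleftrightarrow> G \<subseteq> F)"

(* Equality of combinatorial types of polytopes: isomorphic face lattices. *)
definition combinatorially_equivalent ::
    "'a::euclidean_space set \<Rightarrow> 'b::euclidean_space set \<Rightarrow> bool" where
  "combinatorially_equivalent P Q \<longleftrightarrow>
     (\<exists>f. inclusion_isomorphism f {F. F face_of P} {G. G face_of Q})"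

(* Equality of combinatorial types of Voronoi diagrams: an isomorphism of the induced cell
   complexes of the sphere that carries the diagram to the diagram. *)
definition voronoi_equivalent ::
    "'a::euclidean_space set \<Rightarrow> 'b::euclidean_space set \<Rightarrow> bool" where
  "voronoi_equivalent A B \<longleftrightarrow>
     (\<exists>g. inclusion_isomorphism g (voronoi_cells A) (voronoi_cells B) \<and>
          inclusion_isomorphism g (voronoi_diagram_faces A) (voronoi_diagram_faces B))"

lemma sphere_dist_le_iff:
  assumes "norm x = 1" "norm a = 1" "norm b = 1"
  shows "sphere_dist x a \<le> sphere_dist x b \<longleftrightarrow> x \<bullet> b \<le> x \<bullet> a"
proof -
  have "\<bar>x \<bullet> a\<bar> \<le> 1" "\<bar>x \<bullet> b\<bar> \<le> 1"
    using Cauchy_Schwarz_ineq2[of x a] Cauchy_Schwarz_ineq2[of x b] assms by auto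
  then show ?thesis
    unfolding sphere_dist_def by (simp add: arccos_le_mono)
qed

lemma sphere_dist_less_iff:
  assumes "norm x = 1" "norm a = 1" "norm b = 1"
  shows "sphere_dist x a < sphere_dist x b \<longleftrightarrow> x \<bullet> b < x \<bullet> a"
  using sphere_dist_le_iff[of x b a] assms by linarith

lemma closure_voronoi_domain:
  fixes A :: "'a::euclidean_space set"
  assumes A: "A \<subseteq> sphere 0 1" and a: "a \<in> A"
  shows "closure (voronoi_domain A a) =
    {x \<in> sphere 0 1. \<forall>b\<in>A. sphere_dist x a \<le> sphere_dist x b}" (is "_ = ?R")
proof
  have R: "?R = sphere 0 1 \<inter> (\<Inter>b\<in>A. {x. x \<bullet> b \<le> x \<bullet> a})"
    using A a by (auto simp: sphere_dist_le_iff subset_iff)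
  have "closed ?R"
    unfolding R by (intro closed_Int closed_INT ballI closed_sphere closed_Collect_le continuous_intros)
  moreover have "voronoi_domain A a \<subseteq> ?R"
    unfolding voronoi_domain_def by (auto, metis DiffI order.strict_implies_order order.refl singletonD)
  ultimately show "closure (voronoi_domain A a) \<subseteq> ?R"
    by (rule closure_minimal[rotated])
next
  show "?R \<subseteq> closure (voronoi_domain A a)"
  proof
    fix x assume x: "x \<in> ?R"
    have na: "norm a = 1" and nx: "norm x = 1" using A a x by auto
    define t where "t = (\<lambda>n. 1 / real (Suc (Suc n)))"
    define y where "y = (\<lambda>n. (x + t n *\<^sub>R a) /\<^sub>R norm (x + t n *\<^sub>R a))"
    have t0: "t \<longlonglongrightarrow> 0"
      unfolding t_def using LIMSEQ_Suc[OF LIMSEQ_inverse_real_of_nat] by (simp add: inverse_eq_divide)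
    have "y \<longlonglongrightarrow> (x + 0 *\<^sub>R a) /\<^sub>R norm (x + 0 *\<^sub>R a)"
      unfolding y_def using nx by (intro tendsto_intros t0) auto
    then have lim: "y \<longlonglongrightarrow> x" using nx by simp
    have "y n \<in> voronoi_domain A a" for n
    proof -
      have tn: "0 < t n" "t n < 1" by (auto simp: t_def)
      have "norm (x + t n *\<^sub>R a) \<ge> norm x - norm (t n *\<^sub>R a)"
        by (metis add_diff_cancel_right' norm_triangle_ineq2 norm_minus_cancel
            diff_minus_eq_add)
      then have pos: "norm (x + t n *\<^sub>R a) > 0"
        using tn nx na by (simp del: zero_less_norm_iff)
      then have ny: "norm (y n) = 1" by (simp add: y_def)
      have "y n \<bullet> b < y n \<bullet> a" if b: "b \<in> A" "b \<noteq> a" for b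
      proof -
        have nb: "norm b = 1" using A b by auto
        have "x \<bullet> b \<le> x \<bullet> a" using x b sphere_dist_le_iff[OF nx na nb] by auto
        moreover have "a \<bullet> b < 1"
        proof -
          have "0 < (norm (a - b))\<^sup>2" using b by simp
          also have "\<dots> = 2 - 2 * (a \<bullet> b)"
            using na nb by (simp add: power2_norm_eq_inner inner_diff inner_commute norm_eq_1)
          finally show ?thesis by simp
        qed
        then have "t n * (a \<bullet> b) < t n * (a \<bullet> a)"
          using tn na by (simp add: norm_eq_1)
        ultimately have "(x + t n *\<^sub>R a) \<bullet> b < (x + t n *\<^sub>R a) \<bullet> a"
          by (simp add: inner_add_left)
        then show ?thesis unfolding y_def using pos by (simp add: divide_strict_right_mono)
      qed
      then show ?thesis
        using ny na A unfolding voronoi_domain_def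
        by (auto simp: sphere_dist_less_iff subset_iff)
    qed
    then show "x \<in> closure (voronoi_domain A a)"
      using lim unfolding closure_sequential by blast
  qed
qed

lemma Union_voronoi_diagram_faces:
  fixes A :: "'a::euclidean_space set"
  assumes "finite A" "A \<noteq> {}" "A \<subseteq> sphere 0 1"
  shows "\<Union> (voronoi_diagram_faces A) = voronoi_diagram A"
proof
  show "\<Union> (voronoi_diagram_faces A) \<subseteq> voronoi_diagram A"
    by (auto simp: voronoi_diagram_faces_def)
  show "voronoi_diagram A \<subseteq> \<Union> (voronoi_diagram_faces A)"
  proof
    fix x assume x: "x \<in> voronoi_diagram A"
    define N where "N = (\<lambda>y a. a \<in> A \<and> (\<forall>b\<in>A. sphere_dist y a \<le> sphere_dist y b))"
    obtain a where a: "N x a"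
      using ex_is_arg_min_if_finite[of A "sphere_dist x"] assms
      by (auto simp: is_arg_min_linorder N_def)
    then obtain b where b: "N x b" "b \<noteq> a"
      using x unfolding voronoi_diagram_def N_def by blast
    define C where "C = (\<Inter>c\<in>{a, b}. closure (voronoi_domain A c))"
    have C: "C = {y \<in> sphere 0 1. N y a \<and> N y b}"
      using a b assms(3) unfolding C_def by (auto simp: closure_voronoi_domain N_def)
    have "x \<in> C" using x a b by (auto simp: C voronoi_diagram_def)
    moreover have "C \<subseteq> voronoi_diagram A"
      using b(2) unfolding C voronoi_diagram_def N_def by blast
    moreover have "C \<in> voronoi_cells A"
      unfolding voronoi_cells_def
      using a b \<open>x \<in> C\<close> by (auto simp: N_def intro!: exI[of _ "{a, b}"] simp: C_def)
    ultimately show "x \<in> \<Union> (voronoi_diagram_faces A)"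
      unfolding voronoi_diagram_faces_def by blast
  qed
qed

end

theory Submission
  imports Defs
begin

text \<open>
  A unit vector \<open>u\<close> has the point \<open>a\<close> of \<open>A\<close> as a nearest point exactly if \<open>u \<bullet> a\<close> is the maximum of
  \<open>u \<bullet> _\<close> on \<open>A\<close>, that is, on \<open>Conv(A)\<close>. Hence the closed Voronoi domain of \<open>a\<close> is the set of unit
  outer normals at the vertex \<open>a\<close>, and intersections of closed domains are the sets of unit outer
  normals to faces. A face is recovered from its normals because every proper face is exposed, and
  the normals span the orthogonal complement of the face because a small perturbation of an
  exposing functional within that complement is again exposing.
\<close>

section \<open>Normals and faces of a convex hull\<close>

text \<open>The offset \<open>c\<close> is forced to be the value of \<open>u \<bullet> _\<close> at
  any point of \<open>F\<close>, so nonemptiness of \<open>F\<close> eliminates it. What remains is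
  that every point of \<open>F\<close> maximizes the functional on \<open>P\<close>.\<close>

lemma mem_outer_unit_normals_iff:
  assumes "F \<noteq> {}" "F \<subseteq> P"
  shows "u \<in> outer_unit_normals P F \<longleftrightarrow> norm u = 1 \<and> (\<forall>x\<in>F. \<forall>y\<in>P. u \<bullet> y \<le> u \<bullet> x)"
proof
  assume "norm u = 1 \<and> (\<forall>x\<in>F. \<forall>y\<in>P. u \<bullet> y \<le> u \<bullet> x)"
  moreover obtain a where "a \<in> F" using assms by blast
  ultimately show "u \<in> outer_unit_normals P F"
    unfolding outer_unit_normals_def using assms(2)
    by (auto intro!: exI[of _ "u \<bullet> a"] simp: subset_iff intro: antisym)
qed (auto simp: outer_unit_normals_def subset_iff)

text \<open>Makes a face recoverable from the points of \<open>A\<close> on it, so that linear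
  inequalities over \<open>F\<close> need only be tested on \<open>A \<inter> F\<close>.\<close>

lemma face_of_convex_hull_eq_hull_Int:
  fixes A :: "'a::euclidean_space set"
  assumes "finite A" "F face_of convex hull A"
  shows "F = convex hull (A \<inter> F)"
proof
  obtain S where S: "S \<subseteq> A" "F = convex hull S"
    using face_of_convex_hull_subset[of A F] assms finite_imp_compact by blast
  then show "F \<subseteq> convex hull (A \<inter> F)"
    by (metis hull_mono hull_subset le_inf_iff)
  show "convex hull (A \<inter> F) \<subseteq> F"
    using assms face_of_imp_convex by (intro hull_minimal) auto
qed

lemma ball_convex_hull_inner_le_iff:
  "(\<forall>y\<in>convex hull A. u \<bullet> y \<le> c) \<longleftrightarrow> (\<forall>y\<in>A. u \<bullet> y \<le> c)"
  using hull_minimal[of A "{y. u \<bullet> y \<le> c}" convex] hull_subset[of A convex]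
  by (auto simp: convex_halfspace_le subset_iff)

section \<open>Isomorphisms and dualities of ordered families\<close>

lemma inclusion_isomorphism_transport:
  assumes N: "inclusion_antiisomorphism N X Y" and f: "inclusion_isomorphism f X X'"
    and N': "inclusion_antiisomorphism N' X' Y'"
    and g: "\<And>F. F \<in> X \<Longrightarrow> g (N F) = N' (f F)"
  shows "inclusion_isomorphism g Y Y'"
proof -
  have f': "f F \<in> X'" if "F \<in> X" for F
    using f that by (auto simp: inclusion_isomorphism_def bij_betw_def)
  have Y: "Y = N ` X"
    using N by (auto simp: inclusion_antiisomorphism_def bij_betw_def)
  have "bij_betw (g \<circ> N) X Y'"
  proof -
    have "bij_betw (N' \<circ> f) X Y'"
      using f N' by (auto simp: inclusion_isomorphism_def inclusion_antiisomorphism_def intro: bij_betw_trans)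
    then show ?thesis by (rule bij_betw_cong[THEN iffD1, rotated]) (simp add: g)
  qed
  then have "bij_betw g Y Y'"
    using N unfolding inclusion_antiisomorphism_def by (metis bij_betw_comp_iff)
  moreover have "g (N F) \<subseteq> g (N G) \<longleftrightarrow> N F \<subseteq> N G" if "F \<in> X" "G \<in> X" for F G
    using that f' f N N' by (auto simp: g inclusion_isomorphism_def inclusion_antiisomorphism_def)
  ultimately show ?thesis
    unfolding inclusion_isomorphism_def Y by blast
qed

lemma inclusion_antiisomorphism_subset:
  assumes "inclusion_antiisomorphism N X Y" "X' \<subseteq> X"
  shows "inclusion_antiisomorphism N X' (N ` X')"
  using assms unfolding inclusion_antiisomorphism_def bij_betw_def
  by (meson inj_on_subset subsetD)

lemma inclusion_isomorphism_subset:
  assumes "inclusion_isomorphism f X Y" "X' \<subseteq> X"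
  shows "inclusion_isomorphism f X' (f ` X')"
  using assms unfolding inclusion_isomorphism_def bij_betw_def
  by (meson inj_on_subset subsetD)

lemma inclusion_isomorphism_image_eq:
  assumes "inclusion_isomorphism f X Y"
  shows "f ` X = Y"
  using assms by (simp add: inclusion_isomorphism_def bij_betw_def)

text \<open>The empty face and the whole set are the least and the greatest face. An order
  isomorphism matches them with their counterparts and therefore restricts to the remaining
  faces.\<close>

lemma inclusion_isomorphism_proper_faces:
  fixes P :: "'a::euclidean_space set" and Q :: "'b::euclidean_space set"
  assumes "convex P" "convex Q"
    and f: "inclusion_isomorphism f {F. F face_of P} {G. G face_of Q}"
  shows "inclusion_isomorphism f (proper_faces P) (proper_faces Q)"
proof -
  have im: "f ` {F. F face_of P} = {G. G face_of Q}" and inj: "inj_on f {F. F face_of P}"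
    and ord: "\<And>F G. F face_of P \<Longrightarrow> G face_of P \<Longrightarrow> f F \<subseteq> f G \<longleftrightarrow> F \<subseteq> G"
    using f by (auto simp: inclusion_isomorphism_def bij_betw_def)
  have PP: "P face_of P" and QQ: "Q face_of Q" using assms by (auto simp: face_of_refl)
  obtain E where E: "E face_of P" "f E = {}"
    using equalityD2[OF im] empty_face_of[of Q] by (auto simp: subset_iff image_iff)
  then have "E = {}"
    using ord[of E "{}"] by simp
  with E have fE: "f {} = {}" by simp
  obtain R where R: "R face_of P" "f R = Q"
    using equalityD2[OF im] QQ by (auto simp: subset_iff image_iff)
  have "f P face_of Q" using im PP by blast
  then have "P \<subseteq> R"
    using ord[of P R] R PP by (simp add: face_of_imp_subset)
  with R have fP: "f P = Q" by (metis face_of_imp_subset subset_antisym)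
  have "f ` proper_faces P = proper_faces Q"
  proof -
    have "proper_faces P = {F. F face_of P} - {{}, P}" "proper_faces Q = {F. F face_of Q} - {{}, Q}"
      by (auto simp: proper_faces_def)
    then show ?thesis
      using inj_on_image_set_diff[OF inj, of "{F. F face_of P}" "{{}, P}"] im fE fP PP by auto
  qed
  then show ?thesis
    using inclusion_isomorphism_subset[OF f, of "proper_faces P"] by (auto simp: proper_faces_def)
qed

text \<open>A strict Cauchy-Schwarz inequality. Admitting every \<open>b\<close> in the closed ball
  lets it be applied to all points of the polytope, not only to those of \<open>A\<close>.\<close>

lemma inner_less_1_of_unit:
  assumes "norm a = 1" "norm b \<le> 1" "a \<noteq> b"
  shows "a \<bullet> b < 1"
proof -
  have "0 < (norm (a - b))\<^sup>2" using assms by simp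
  also have "\<dots> = 1 + (norm b)\<^sup>2 - 2 * (a \<bullet> b)"
    using assms by (simp add: power2_norm_eq_inner inner_diff inner_commute norm_eq_1)
  also have "\<dots> \<le> 2 - 2 * (a \<bullet> b)"
    using assms by (simp add: power_le_one)
  finally show ?thesis by simp
qed

section \<open>Full-dimensional polytopes inscribed in the sphere\<close>

text \<open>The hyperplanes are affine, with arbitrary offset \<open>c\<close>, so the last
  assumption makes the hull full-dimensional. The origin may lie outside the hull.\<close>

locale spherical_configuration =
  fixes A :: "'a::euclidean_space set"
  assumes finite_A: "finite A"
    and A_subset_sphere: "A \<subseteq> sphere 0 1"
    and not_in_hyperplane: "\<not> (\<exists>w c. w \<noteq> 0 \<and> A \<subseteq> {x. w \<bullet> x = c})"
begin

abbreviation "P \<equiv> convex hull A"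
abbreviation "N \<equiv> outer_unit_normals P"

lemma norm_A: "a \<in> A \<Longrightarrow> norm a = 1"
  using A_subset_sphere by auto

lemma A_subset_P: "A \<subseteq> P"
  by (rule hull_subset)

lemma P_not_in_hyperplane:
  assumes "w \<noteq> 0"
  shows "\<not> P \<subseteq> {x. w \<bullet> x = c}"
  using assms not_in_hyperplane subset_trans[OF A_subset_P, of "{x. w \<bullet> x = c}"] by blast

lemma aff_dim_P: "aff_dim P = int DIM('a)"
proof (rule ccontr)
  assume "aff_dim P \<noteq> int DIM('a)"
  then have "aff_dim P < int DIM('a)"
    using aff_dim_le_DIM[of P] by linarith
  then show False
    using P_not_in_hyperplane by (metis aff_lowdim_subset_hyperplane)
qed

lemma nearest_iff:
  assumes "norm x = 1" "a \<in> A"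
  shows "(\<forall>b\<in>A. sphere_dist x a \<le> sphere_dist x b) \<longleftrightarrow> (\<forall>y\<in>P. x \<bullet> y \<le> x \<bullet> a)"
  using assms norm_A by (simp add: ball_convex_hull_inner_le_iff sphere_dist_le_iff)

lemma mem_normals_singleton_iff:
  assumes "a \<in> A"
  shows "u \<in> N {a} \<longleftrightarrow> norm u = 1 \<and> (\<forall>y\<in>P. u \<bullet> y \<le> u \<bullet> a)"
  using assms A_subset_P by (subst mem_outer_unit_normals_iff) auto

lemma closure_voronoi_domain_eq_normals:
  assumes "a \<in> A"
  shows "closure (voronoi_domain A a) = N {a}"
proof -
  have "u \<in> closure (voronoi_domain A a) \<longleftrightarrow> u \<in> N {a}" for u
    using nearest_iff[OF _ assms, of u]
    by (auto simp: mem_normals_singleton_iff[OF assms] closure_voronoi_domain[OF A_subset_sphere assms])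
  then show ?thesis by blast
qed

lemma proper_faceD:
  assumes "F \<in> proper_faces P"
  shows "F face_of P" "F \<noteq> {}" "F \<noteq> P" "F \<subseteq> P" "F = convex hull (A \<inter> F)" "A \<inter> F \<noteq> {}"
    "0 \<le> aff_dim F"
proof -
  show *: "F face_of P" "F \<noteq> {}" "F \<noteq> P" using assms by (auto simp: proper_faces_def)
  then show "F \<subseteq> P" by (simp add: face_of_imp_subset)
  show "F = convex hull (A \<inter> F)"
    using face_of_convex_hull_eq_hull_Int finite_A * by blast
  with * show "A \<inter> F \<noteq> {}" by (metis convex_hull_empty)
  show "0 \<le> aff_dim F"
    using * aff_dim_geq[of F] aff_dim_empty[of F] by linarith
qed

text \<open>Proper faces of a polyhedron are exposed, and an exposing functional can be scaled to
  unit length. The strict inequality off \<open>F\<close> is what later recovers \<open>F\<close>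
  from its normals and leaves room for perturbation.\<close>

lemma proper_face_exposed:
  assumes "F \<in> proper_faces P"
  obtains u where "u \<in> N F" "\<And>x y. x \<in> F \<Longrightarrow> y \<in> P \<Longrightarrow> y \<notin> F \<Longrightarrow> u \<bullet> y < u \<bullet> x"
proof -
  note F = proper_faceD[OF assms]
  have "polyhedron P"
    using finite_A by (simp add: polyhedron_convex_hull)
  then have "F exposed_face_of P"
    using F by (simp add: exposed_face_of_polyhedron)
  then obtain w c where w: "w \<noteq> 0" "P \<subseteq> {x. w \<bullet> x \<le> c}" "F = P \<inter> {x. w \<bullet> x = c}"
    unfolding exposed_face_of using F by blast
  define u where "u = w /\<^sub>R norm w"
  have "u \<bullet> y < u \<bullet> x" if "x \<in> F" "y \<in> P" "y \<notin> F" for x y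
  proof -
    have "w \<bullet> y < w \<bullet> x" using that w by fastforce
    then show ?thesis using w(1) by (simp add: u_def divide_strict_right_mono)
  qed
  moreover have "u \<bullet> y = u \<bullet> x" if "x \<in> F" "y \<in> F" for x y
    using that w by (simp add: u_def)
  moreover have "norm u = 1" using w by (simp add: u_def)
  ultimately have "u \<in> N F"
    unfolding mem_outer_unit_normals_iff[OF F(2,4)] by (metis less_imp_le order.refl)
  with \<open>\<And>y x. x \<in> F \<Longrightarrow> y \<in> P \<Longrightarrow> y \<notin> F \<Longrightarrow> u \<bullet> y < u \<bullet> x\<close> show ?thesis using that by blast
qed

section \<open>Voronoi cells as sets of outer normals\<close>

text \<open>Since \<open>F\<close> is the hull of \<open>A \<inter> F\<close>, a functional that is
  maximal at each of these points is maximal on all of \<open>F\<close>.\<close>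

lemma normals_eq_Inter_domains:
  assumes "F \<in> proper_faces P"
  shows "N F = (\<Inter>a\<in>A \<inter> F. closure (voronoi_domain A a))"
proof -
  note F = proper_faceD[OF assms]
  have "u \<in> N F" if "\<forall>a\<in>A \<inter> F. u \<in> N {a}" for u
  proof -
    have *: "norm u = 1 \<and> (\<forall>y\<in>P. u \<bullet> y \<le> u \<bullet> a)" if a: "a \<in> A \<inter> F" for a
      using \<open>\<forall>a\<in>A \<inter> F. u \<in> N {a}\<close> a mem_normals_singleton_iff by blast
    have "u \<bullet> y \<le> u \<bullet> x" if "y \<in> P" "x \<in> F" for x y
    proof -
      \<comment> \<open>Changing the sign turns the lower bound \<open>u \<bullet> y\<close> for the
        values on \<open>A \<inter> F\<close> into an upper bound, which passes to the hull.\<close>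
      have "\<forall>x\<in>A \<inter> F. (- u) \<bullet> x \<le> - (u \<bullet> y)" using * that by auto
      then have "\<forall>x\<in>F. (- u) \<bullet> x \<le> - (u \<bullet> y)"
        using F(5) ball_convex_hull_inner_le_iff[of "A \<inter> F" "- u"] by metis
      with that show ?thesis by auto
    qed
    then show ?thesis
      using F(6) * unfolding mem_outer_unit_normals_iff[OF F(2,4)] by blast
  qed
  moreover have "N F \<subseteq> N {a}" if "a \<in> F" for a
    using that by (auto simp: outer_unit_normals_def)
  ultimately show ?thesis
    by (auto simp: closure_voronoi_domain_eq_normals subset_iff)
qed

lemma normals_nonempty:
  assumes "F \<in> proper_faces P"
  shows "N F \<noteq> {}"
  using proper_face_exposed[OF assms] by (metis empty_iff)

text \<open>For the forward direction, take a normal \<open>u\<close> that exposes \<open>F\<close>.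
  If \<open>u\<close> is also a normal to \<open>G\<close>, then all points of \<open>G\<close>
  maximize it on \<open>P\<close>, and its maximizers are exactly the points of
  \<open>F\<close>.\<close>

lemma normals_subset_iff:
  assumes F: "F \<in> proper_faces P" and G: "G \<in> proper_faces P"
  shows "N F \<subseteq> N G \<longleftrightarrow> G \<subseteq> F"
proof
  assume "N F \<subseteq> N G"
  obtain u where u: "u \<in> N F" "\<And>x y. x \<in> F \<Longrightarrow> y \<in> P \<Longrightarrow> y \<notin> F \<Longrightarrow> u \<bullet> y < u \<bullet> x"
    using proper_face_exposed[OF F] by blast
  then have "u \<in> N G" using \<open>N F \<subseteq> N G\<close> by blast
  show "G \<subseteq> F"
  proof
    fix y assume y: "y \<in> G"
    obtain x where x: "x \<in> F" using proper_faceD[OF F] by blast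
    have "u \<bullet> x \<le> u \<bullet> y"
      using \<open>u \<in> N G\<close> x y proper_faceD[OF G] proper_faceD(4)[OF F]
      by (auto simp: mem_outer_unit_normals_iff)
    then show "y \<in> F" using u(2)[OF x] y proper_faceD(4)[OF G] by fastforce
  qed
qed (auto simp: outer_unit_normals_def)

text \<open>The set \<open>B\<close> defining a cell need not be the set of all points of
  \<open>A\<close> on a face, so it is replaced by the smallest face \<open>F\<close> containing it.
  For \<open>u\<close> in the cell, the maximizers of \<open>u\<close> on \<open>P\<close> form a
  face containing \<open>B\<close>, hence containing \<open>F\<close>; thus \<open>u\<close> is
  normal to \<open>F\<close>.\<close>

lemma voronoi_cell_is_normals:
  assumes "C \<in> voronoi_cells A"
  shows "C \<in> N ` proper_faces P"
proof -
  obtain B where B: "B \<noteq> {}" "B \<subseteq> A" and C: "C = (\<Inter>a\<in>B. closure (voronoi_domain A a))"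
    and "C \<noteq> {}"
    using assms by (auto simp: voronoi_cells_def)
  define F where "F = \<Inter> {G. G face_of P \<and> B \<subseteq> G}"
  have BP: "B \<subseteq> P" using B A_subset_P by blast
  have "P face_of P" by (simp add: face_of_refl)
  then have F: "F face_of P"
    unfolding F_def using BP by (intro face_of_Inter) auto
  have BF: "B \<subseteq> F" by (auto simp: F_def)
  have C_eq: "C = {u. norm u = 1 \<and> (\<forall>a\<in>B. \<forall>y\<in>P. u \<bullet> y \<le> u \<bullet> a)}"
  proof -
    have "u \<in> N {a} \<longleftrightarrow> norm u = 1 \<and> (\<forall>y\<in>P. u \<bullet> y \<le> u \<bullet> a)" if "a \<in> B" for u a
      using that B by (auto simp: mem_normals_singleton_iff)
    then show ?thesis
      unfolding C using B by (auto simp: closure_voronoi_domain_eq_normals subset_iff)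
  qed
  have CF: "F \<subseteq> P \<inter> {x. u \<bullet> x = c}" if u: "u \<in> C" "P \<subseteq> {x. u \<bullet> x \<le> c}" "B \<subseteq> {x. u \<bullet> x = c}" for u c
  proof -
    have "(P \<inter> {x. u \<bullet> x = c}) face_of P"
      using u by (intro face_of_Int_supporting_hyperplane_le) auto
    then show ?thesis
      unfolding F_def using u BP by blast
  qed
  have CN: "C \<subseteq> N F"
  proof
    fix u assume u: "u \<in> C"
    obtain b where b: "b \<in> B" using B by blast
    have "P \<subseteq> {x. u \<bullet> x \<le> u \<bullet> b}" "B \<subseteq> {x. u \<bullet> x = u \<bullet> b}"
      using u b BP by (auto simp: C_eq intro!: antisym)
    with CF[OF u] u show "u \<in> N F"
      by (auto simp: outer_unit_normals_def C_eq)
  qed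
  \<comment> \<open>Nonemptiness of the cell enters here: a unit normal to \<open>P\<close> itself
    would be constant on \<open>P\<close> and put it in a hyperplane.\<close>
  have "F \<noteq> P"
  proof
    assume "F = P"
    obtain u where "u \<in> N P" using CN \<open>C \<noteq> {}\<close> \<open>F = P\<close> by blast
    then obtain c where "norm u = 1" "P \<subseteq> {x. u \<bullet> x = c}"
      by (auto simp: outer_unit_normals_def)
    then show False using P_not_in_hyperplane[of u c] by fastforce
  qed
  then have "F \<in> proper_faces P"
    using F B BF by (auto simp: proper_faces_def)
  moreover have "N F \<subseteq> C"
    using mem_outer_unit_normals_iff[OF proper_faceD(2,4)[OF \<open>F \<in> proper_faces P\<close>]] BF
    by (auto simp: C_eq)
  ultimately show ?thesis using CN by blast
qed

lemma antiisomorphism_normals: "inclusion_antiisomorphism N (proper_faces P) (voronoi_cells A)"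
proof -
  have "inj_on N (proper_faces P)"
    using normals_subset_iff by (intro inj_onI) (metis subset_antisym subset_refl)
  moreover have "N F \<in> voronoi_cells A" if "F \<in> proper_faces P" for F
    unfolding voronoi_cells_def mem_Collect_eq
    using normals_nonempty[OF that] normals_eq_Inter_domains[OF that] proper_faceD(6)[OF that]
    by (metis Int_lower1)
  ultimately show ?thesis
    unfolding inclusion_antiisomorphism_def bij_betw_def
    using voronoi_cell_is_normals normals_subset_iff by auto
qed

lemma voronoi_cells_eq: "voronoi_cells A = N ` proper_faces P"
  using antiisomorphism_normals by (simp add: inclusion_antiisomorphism_def bij_betw_def)

section \<open>Faces of the diagram\<close>

text \<open>For a vertex \<open>a\<close>, the point \<open>a\<close> is itself a normal at
  \<open>a\<close> and has \<open>a\<close> as its only nearest point. A face of positive dimension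
  contains two points of \<open>A\<close>, and both are nearest to each of its normals.\<close>

lemma normals_subset_diagram_iff:
  assumes "F \<in> proper_faces P"
  shows "N F \<subseteq> voronoi_diagram A \<longleftrightarrow> 1 \<le> aff_dim F"
proof
  note F = proper_faceD[OF assms]
  show "1 \<le> aff_dim F" if "N F \<subseteq> voronoi_diagram A"
  proof (rule ccontr)
    assume "\<not> 1 \<le> aff_dim F"
    then have "aff_dim F = 0" using F(7) by linarith
    then obtain a where a: "F = {a}" by (auto simp: aff_dim_eq_0)
    then have aA: "a \<in> A" using F by blast
    have less: "a \<bullet> b < a \<bullet> a" if "b \<in> A" "b \<noteq> a" for b
      using that inner_less_1_of_unit[of a b] norm_A[OF aA] norm_A[of b] by (simp add: norm_eq_1)
    then have "\<forall>b\<in>A. a \<bullet> b \<le> a \<bullet> a" by force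
    then have "a \<in> N F"
      using aA norm_A by (simp add: a mem_normals_singleton_iff ball_convex_hull_inner_le_iff)
    moreover have "a \<notin> voronoi_diagram A"
    proof -
      have "\<exists>!c. c \<in> A \<and> (\<forall>b\<in>A. sphere_dist a c \<le> sphere_dist a b)"
        using less aA norm_A
        by (intro ex1I[of _ a]) (auto simp: sphere_dist_le_iff, force+)
      then show ?thesis by (simp add: voronoi_diagram_def)
    qed
    ultimately show False using that by blast
  qed
  show "N F \<subseteq> voronoi_diagram A" if "1 \<le> aff_dim F"
  proof
    fix u assume u: "u \<in> N F"
    obtain a where a: "a \<in> A \<inter> F" using F by blast
    have "A \<inter> F \<noteq> {a}"
    proof
      assume "A \<inter> F = {a}"
      then have "F = {a}" using F(5) by simp
      with that show False by simp
    qed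
    then obtain b where b: "b \<in> A \<inter> F" "b \<noteq> a" using a by blast
    have nu: "norm u = 1" and "\<forall>x\<in>F. \<forall>y\<in>P. u \<bullet> y \<le> u \<bullet> x"
      using u F by (auto simp: mem_outer_unit_normals_iff)
    then have "\<forall>d\<in>A. sphere_dist u c \<le> sphere_dist u d" if "c \<in> A \<inter> F" for c
      using that nearest_iff by blast
    then show "u \<in> voronoi_diagram A"
      using a b nu unfolding voronoi_diagram_def by auto
  qed
qed

lemma voronoi_diagram_faces_eq:
  "voronoi_diagram_faces A = N ` {F \<in> proper_faces P. 1 \<le> aff_dim F}"
  unfolding voronoi_diagram_faces_def voronoi_cells_eq using normals_subset_diagram_iff by auto

section \<open>Dimensions of dual cells\<close>

text \<open>Translating \<open>F\<close> by \<open>- a\<close> makes its affine hull linear, so the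
  right-hand side is the orthogonal complement of the direction space of \<open>F\<close>.\<close>

lemma span_normals:
  assumes "F \<in> proper_faces P" "a \<in> F"
  shows "span (N F) = {y. \<forall>x\<in>span ((+) (- a) ` F). orthogonal x y}"
proof
  note F = proper_faceD[OF assms(1)]
  let ?D = "(+) (- a) ` F"
  let ?L = "{y. \<forall>x\<in>span ?D. orthogonal x y}"
  have "u \<in> ?L" if "u \<in> N F" for u
  proof -
    have "u \<bullet> x = u \<bullet> a" if "x \<in> F" for x
      using that \<open>u \<in> N F\<close> assms(2) by (auto simp: outer_unit_normals_def subset_iff)
    then have "\<forall>x\<in>?D. orthogonal u x"
      by (auto simp: orthogonal_def inner_diff_right)
    then have "orthogonal u x" if "x \<in> span ?D" for x
      using that by (metis orthogonal_to_span)
    then show ?thesis unfolding mem_Collect_eq by (metis orthogonal_commute)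
  qed
  then show "span (N F) \<subseteq> ?L"
    by (intro span_minimal subspace_orthogonal_to_vectors) auto
  show "?L \<subseteq> span (N F)"
  proof
    fix v assume "v \<in> ?L"
    then have v: "v \<bullet> x = v \<bullet> a" if "x \<in> F" for x
      using that span_base[of "- a + x" ?D] by (auto simp: orthogonal_def inner_commute inner_diff_right)
    \<comment> \<open>Perturbed functionals are no longer unit vectors and might vanish, so
      membership in the span is settled for vectors of any length.\<close>
    have in_span: "w \<in> span (N F)" if w: "\<forall>x\<in>F. \<forall>y\<in>P. w \<bullet> y \<le> w \<bullet> x" for w
    proof (cases "w = 0")
      case False
      then have "w /\<^sub>R norm w \<in> N F"
        using w F by (subst mem_outer_unit_normals_iff) (auto simp: divide_right_mono)
      then have "norm w *\<^sub>R (w /\<^sub>R norm w) \<in> span (N F)" by (intro span_mul span_base)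
      with False show ?thesis by simp
    qed (simp add: span_zero)
    obtain u where u: "u \<in> N F" "\<And>x y. x \<in> F \<Longrightarrow> y \<in> P \<Longrightarrow> y \<notin> F \<Longrightarrow> u \<bullet> y < u \<bullet> x"
      using proper_face_exposed[OF assms(1)] by blast
    have ux: "u \<bullet> x = u \<bullet> a" if "x \<in> F" for x
      using that u(1) assms(2) by (auto simp: outer_unit_normals_def subset_iff)
    have "\<forall>\<^sub>F t in at_right (0::real). \<forall>b\<in>A - F. (u + t *\<^sub>R v) \<bullet> (b - a) < 0"
    \<comment> \<open>At \<open>t = 0\<close> the inequalities are strict because \<open>u\<close>
      exposes \<open>F\<close>. There are finitely many of them, so they persist for all small
      \<open>t > 0\<close>.\<close>
    proof (intro eventually_ball_finite ballI)
      fix b assume b: "b \<in> A - F"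
      have "((\<lambda>t. (u + t *\<^sub>R v) \<bullet> (b - a)) \<longlongrightarrow> (u + 0 *\<^sub>R v) \<bullet> (b - a)) (at_right 0)"
        by (intro tendsto_intros)
      moreover have "(u + 0 *\<^sub>R v) \<bullet> (b - a) < 0"
        using b u(2)[of a b] assms(2) A_subset_P by (auto simp: inner_diff_right)
      ultimately show "\<forall>\<^sub>F t in at_right (0::real). (u + t *\<^sub>R v) \<bullet> (b - a) < 0"
        by (rule order_tendstoD)
    qed (use finite_A in auto)
    then have "\<forall>\<^sub>F t in at_right (0::real). 0 < t \<and> (\<forall>b\<in>A - F. (u + t *\<^sub>R v) \<bullet> (b - a) < 0)"
      using eventually_at_right_less by (rule eventually_conj[rotated])
    then obtain t :: real where t: "0 < t" "\<forall>b\<in>A - F. (u + t *\<^sub>R v) \<bullet> (b - a) < 0"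
      using eventually_happens trivial_limit_at_right_real by blast
    define w where "w = u + t *\<^sub>R v"
    \<comment> \<open>On \<open>F\<close> the perturbation changes nothing essential, since
      \<open>u\<close> and \<open>v\<close> are both constant there. Hence \<open>w\<close> is
      maximal on \<open>F\<close>, and \<open>v\<close> is recovered as a multiple of
      \<open>w - u\<close>.\<close>
    have wx: "w \<bullet> x = w \<bullet> a" if "x \<in> F" for x
      using ux[OF that] v[OF that] by (simp add: w_def inner_add_left)
    have "w \<bullet> b \<le> w \<bullet> a" if "b \<in> A" for b
      using t(2) that wx by (cases "b \<in> F") (auto simp: w_def[symmetric] inner_diff_right less_imp_le)
    then have "\<forall>y\<in>P. w \<bullet> y \<le> w \<bullet> a"
      by (simp add: ball_convex_hull_inner_le_iff)
    then have "w \<in> span (N F)"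
      by (intro in_span) (simp add: wx)
    then have "(w - u) /\<^sub>R t \<in> span (N F)"
      using u(1) by (intro span_mul span_diff) (auto intro: span_base)
    then show "v \<in> span (N F)" using t(1) by (simp add: w_def)
  qed
qed

lemma dim_normals:
  assumes "F \<in> proper_faces P"
  shows "int (dim (N F)) = int DIM('a) - aff_dim F"
proof -
  obtain a where a: "a \<in> F" using proper_faceD[OF assms] by blast
  let ?D = "(+) (- a) ` F"
  have "aff_dim F = int (dim ?D)"
    using a by (intro aff_dim_eq_dim) (simp add: hull_inc)
  moreover have "dim (N F) + dim ?D = DIM('a)"
    using dim_subspace_orthogonal_to_vectors[of "span ?D" UNIV] span_normals[OF assms a]
    by (metis (no_types, lifting) Collect_cong UNIV_I dim_UNIV dim_span subset_UNIV subspace_UNIV subspace_span)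
  ultimately show ?thesis by linarith
qed

section \<open>Vertices and minimal proper faces\<close>

text \<open>On the unit ball the functional \<open>a \<bullet> _\<close> attains its maximum 1 only
  at \<open>a\<close>, so each point of \<open>A\<close> is an exposed vertex of the hull.\<close>

lemma singleton_proper_face:
  assumes "a \<in> A"
  shows "{a} \<in> proper_faces P"
proof -
  have "P \<subseteq> cball 0 1"
    using A_subset_sphere by (intro hull_minimal) auto
  then have less: "a \<bullet> x < 1" if "x \<in> P" "x \<noteq> a" for x
    using that assms norm_A by (intro inner_less_1_of_unit) auto
  have aa: "a \<bullet> a = 1" using assms norm_A by (simp add: norm_eq_1)
  have "P \<inter> {x. a \<bullet> x = 1} face_of P"
    using less aa by (intro face_of_Int_supporting_hyperplane_le) (auto intro: less_imp_le, metis less_imp_le order.refl)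
  moreover have "P \<inter> {x. a \<bullet> x = 1} = {a}"
    using less aa assms A_subset_P by force
  moreover have "{a} \<noteq> P"
  proof
    assume "{a} = P"
    moreover have "a \<noteq> 0" using aa by auto
    ultimately show False using P_not_in_hyperplane[of a 1] aa by auto
  qed
  ultimately show ?thesis by (simp add: proper_faces_def)
qed

text \<open>Expresses the dimension condition by inclusion alone, so that isomorphisms of face
  lattices respect it. Every proper face contains a point of \<open>A\<close>, which is a proper
  face by itself; the minimal ones are thus singletons.\<close>

lemma one_le_aff_dim_iff_not_minimal:
  assumes "F \<in> proper_faces P"
  shows "1 \<le> aff_dim F \<longleftrightarrow> (\<exists>G\<in>proper_faces P. G \<subset> F)"
proof
  note F = proper_faceD[OF assms]
  obtain a where a: "a \<in> A" "a \<in> F" using F by blast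
  show "\<exists>G\<in>proper_faces P. G \<subset> F" if "1 \<le> aff_dim F"
  proof -
    have "F \<noteq> {a}" using that by auto
    then show ?thesis using a singleton_proper_face by blast
  qed
  show "1 \<le> aff_dim F" if "\<exists>G\<in>proper_faces P. G \<subset> F"
  proof -
    have "aff_dim F \<noteq> 0" using that proper_faceD(2) by (auto simp: aff_dim_eq_0)
    then show ?thesis using F(7) by linarith
  qed
qed

section \<open>Facets and Voronoi vertices\<close>

lemma facet_of_iff:
  "F facet_of P \<longleftrightarrow> F \<in> proper_faces P \<and> aff_dim F = int DIM('a) - 1"
  by (auto simp: facet_of_def proper_faces_def aff_dim_P)

text \<open>By the dimension formula, facets are the proper faces whose normals span a line. Such a
  line holds just two unit vectors, which cannot both be normals.\<close>

lemma normals_singleton_iff: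
  assumes "F \<in> proper_faces P"
  shows "(\<exists>v. N F = {v}) \<longleftrightarrow> F facet_of P"
proof
  note F = proper_faceD[OF assms]
  obtain u where u: "u \<in> N F" using normals_nonempty[OF assms] by blast
  have norm1: "norm v = 1" if "v \<in> N F" for v using that by (simp add: outer_unit_normals_def)
  show "F facet_of P" if "\<exists>v. N F = {v}"
  proof -
    have "N F = {u}" using that u by auto
    moreover have "u \<noteq> 0" using norm1[OF u] by auto
    ultimately have "dim (N F) = 1" by simp
    then show ?thesis using dim_normals[OF assms] assms by (simp add: facet_of_iff)
  qed
  show "\<exists>v. N F = {v}" if "F facet_of P"
  proof -
    have dim1: "dim (N F) = 1" using that dim_normals[OF assms] by (simp add: facet_of_iff)
    have "v = u" if v: "v \<in> N F" for v
    proof -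
      have "u \<noteq> 0" using norm1[OF u] by auto
      then have "span {u} = span (N F)"
        using dim1 u by (intro dim_eq_span) auto
      then obtain k where k: "v = k *\<^sub>R u"
        using span_base[OF v] by (auto simp: span_singleton)
      then have "k = 1 \<or> k = - 1" using norm1[OF u] norm1[OF v] by auto
      \<comment> \<open>If \<open>u\<close> and \<open>- u\<close> were both maximal at
        \<open>a\<close>, then \<open>u\<close> would be constant on \<open>P\<close>, against full
        dimensionality.\<close>
      moreover have False if "k = - 1"
      proof -
        have vu: "v = - u" using that k by simp
        obtain a where a: "a \<in> F" using F by blast
        have "u \<bullet> y \<le> u \<bullet> a" "v \<bullet> y \<le> v \<bullet> a" if "y \<in> P" for y
          using u v a that F by (auto simp: mem_outer_unit_normals_iff)
        then have "P \<subseteq> {y. u \<bullet> y = u \<bullet> a}" by (auto simp: vu intro: antisym)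
        then show False using P_not_in_hyperplane \<open>u \<noteq> 0\<close> by blast
      qed
      ultimately show ?thesis using k by auto
    qed
    with u show ?thesis by blast
  qed
qed

text \<open>The predicate \<open>Q\<close> allows one argument to cover both the vertices of the
  whole cell complex and those of the diagram.\<close>

lemma Union_singletons_of_normals:
  "{v. {v} \<in> N ` {F \<in> proper_faces P. Q F}} = (\<Union>F\<in>{F. F facet_of P \<and> Q F}. N F)"
proof (intro subset_antisym subsetI)
  fix v assume "v \<in> {v. {v} \<in> N ` {F \<in> proper_faces P. Q F}}"
  then obtain F where "F \<in> proper_faces P" "Q F" "N F = {v}" by auto
  then show "v \<in> (\<Union>F\<in>{F. F facet_of P \<and> Q F}. N F)"
    using normals_singleton_iff[of F] by auto
next
  fix v assume "v \<in> (\<Union>F\<in>{F. F facet_of P \<and> Q F}. N F)"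
  then obtain F where F: "F facet_of P" "Q F" "v \<in> N F" by auto
  then have "F \<in> proper_faces P" by (simp add: facet_of_iff)
  moreover from this have "N F = {v}"
    using F normals_singleton_iff[of F] by auto
  ultimately show "v \<in> {v. {v} \<in> N ` {F \<in> proper_faces P. Q F}}"
    using F(2) by (metis (mono_tags, lifting) imageI mem_Collect_eq)
qed

lemma voronoi_cell_vertices:
  "{v. {v} \<in> voronoi_cells A} = (\<Union>F\<in>{F. F facet_of P}. N F)"
  using Union_singletons_of_normals[of "\<lambda>_. True"] by (simp add: voronoi_cells_eq)

text \<open>From dimension two on, every facet has positive dimension, so its normal lies in the
  diagram. In dimension one the facets are points and their normals lie outside it.\<close>

lemma voronoi_vertices_eq:
  assumes "2 \<le> DIM('a)"
  shows "voronoi_vertices A = (\<Union>F\<in>{F. F facet_of P}. N F)"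
proof -
  have "{F. F facet_of P \<and> 1 \<le> aff_dim F} = {F. F facet_of P}"
    using assms by (auto simp: facet_of_iff)
  then show ?thesis
    using Union_singletons_of_normals[of "\<lambda>F. 1 \<le> aff_dim F"]
    by (simp add: voronoi_vertices_def voronoi_diagram_faces_eq)
qed

end

section \<open>Combinatorial types\<close>

text \<open>
  The faces whose normals lie in the diagram are the non-minimal proper faces, so an isomorphism of
  face lattices preserves them.
\<close>

lemma voronoi_equivalent_if_combinatorially_equivalent:
  fixes A :: "'a::euclidean_space set" and A' :: "'b::euclidean_space set"
  assumes "spherical_configuration A" "spherical_configuration A'"
    and "combinatorially_equivalent (convex hull A) (convex hull A')"
  shows "voronoi_equivalent A A'"
proof -
  interpret S: spherical_configuration A by fact
  interpret S': spherical_configuration A' by fact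
  obtain f where "inclusion_isomorphism f {F. F face_of S.P} {G. G face_of S'.P}"
    using assms(3) by (auto simp: combinatorially_equivalent_def)
  then have f: "inclusion_isomorphism f (proper_faces S.P) (proper_faces S'.P)"
    by (intro inclusion_isomorphism_proper_faces) auto
  define X where "X = {F \<in> proper_faces S.P. 1 \<le> aff_dim F}"
  define X' where "X' = {F \<in> proper_faces S'.P. 1 \<le> aff_dim F}"
  have im: "f ` proper_faces S.P = proper_faces S'.P"
    by (rule inclusion_isomorphism_image_eq[OF f])
  have ord: "f G \<subset> f F \<longleftrightarrow> G \<subset> F" if "F \<in> proper_faces S.P" "G \<in> proper_faces S.P" for F G
    using f that by (auto simp: inclusion_isomorphism_def less_le_not_le)
  have "1 \<le> aff_dim (f F) \<longleftrightarrow> 1 \<le> aff_dim F" if F: "F \<in> proper_faces S.P" for F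
  proof -
    have "f F \<in> proper_faces S'.P" using im F by blast
    then have "1 \<le> aff_dim (f F) \<longleftrightarrow> (\<exists>G\<in>f ` proper_faces S.P. G \<subset> f F)"
      by (simp add: S'.one_le_aff_dim_iff_not_minimal im)
    then show ?thesis
      using F by (simp add: S.one_le_aff_dim_iff_not_minimal ord)
  qed
  then have fX: "f ` X = X'"
    unfolding X_def X'_def im[symmetric] by auto
  have sub: "X \<subseteq> proper_faces S.P" "X' \<subseteq> proper_faces S'.P"
    by (auto simp: X_def X'_def)
  \<comment> \<open>The map on cells goes from a cell back to its face, across by \<open>f\<close>,
    and on to the dual cell. The same \<open>g\<close> has to serve for all cells and for the faces
    of the diagram.\<close>
  define g where "g = (\<lambda>C. S'.N (f (the_inv_into (proper_faces S.P) S.N C)))"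
  have g: "g (S.N F) = S'.N (f F)" if "F \<in> proper_faces S.P" for F
    using S.antiisomorphism_normals that
    by (simp add: g_def inclusion_antiisomorphism_def bij_betw_def the_inv_into_f_f)
  have "inclusion_isomorphism g (voronoi_cells A) (voronoi_cells A')"
    by (rule inclusion_isomorphism_transport[OF S.antiisomorphism_normals f S'.antiisomorphism_normals g])
  moreover have "inclusion_isomorphism g (S.N ` X) (S'.N ` X')"
  proof (rule inclusion_isomorphism_transport)
    show "inclusion_antiisomorphism S.N X (S.N ` X)"
      by (rule inclusion_antiisomorphism_subset[OF S.antiisomorphism_normals sub(1)])
    show "inclusion_isomorphism f X X'"
      using inclusion_isomorphism_subset[OF f sub(1)] by (simp only: fX)
    show "inclusion_antiisomorphism S'.N X' (S'.N ` X')"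
      by (rule inclusion_antiisomorphism_subset[OF S'.antiisomorphism_normals sub(2)])
    show "g (S.N F) = S'.N (f F)" if "F \<in> X" for F
      using g sub(1) that by blast
  qed
  ultimately show ?thesis
    unfolding voronoi_equivalent_def S.voronoi_diagram_faces_eq S'.voronoi_diagram_faces_eq X_def X'_def
    by blast
qed

text \<open>Duality is rendered as an inclusion-reversing bijection with complementary dimensions.
  Its two extreme cases are spelled out: vertices of the hull give closed domains, and facets give
  vertices of the cell complex.\<close>

theorem lemma3:
  fixes A :: "'a::euclidean_space set"
  assumes "finite A"
    and "A \<subseteq> sphere 0 1"
    and "\<not> (\<exists>w c. w \<noteq> 0 \<and> A \<subseteq> {x. w \<bullet> x = c})"
  shows
    "inclusion_antiisomorphism (outer_unit_normals (convex hull A))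
       (proper_faces (convex hull A)) (voronoi_cells A) \<and>
     outer_unit_normals (convex hull A) ` {F \<in> proper_faces (convex hull A). 1 \<le> aff_dim F}
       = voronoi_diagram_faces A \<and>
     (\<forall>F \<in> proper_faces (convex hull A).
        spherical_dim (outer_unit_normals (convex hull A) F) = int DIM('a) - 1 - aff_dim F) \<and>
     (\<forall>a\<in>A. {a} \<in> proper_faces (convex hull A) \<and>
        outer_unit_normals (convex hull A) {a} = closure (voronoi_domain A a)) \<and>
     {v. {v} \<in> voronoi_cells A} =
       (\<Union>F \<in> {F. F facet_of convex hull A}. outer_unit_normals (convex hull A) F) \<and>
     (2 \<le> DIM('a) \<longrightarrow>
        voronoi_vertices A =
          (\<Union>F \<in> {F. F facet_of convex hull A}. outer_unit_normals (convex hull A) F)) \<and>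
     (\<forall>A' :: 'a set.
        finite A' \<and> A' \<subseteq> sphere 0 1 \<and> \<not> (\<exists>w c. w \<noteq> 0 \<and> A' \<subseteq> {x. w \<bullet> x = c}) \<and>
        combinatorially_equivalent (convex hull A) (convex hull A') \<longrightarrow>
        voronoi_equivalent A A')"
proof -
  interpret spherical_configuration A
    using assms by unfold_locales
  have dims: "spherical_dim (N F) = int DIM('a) - 1 - aff_dim F" if "F \<in> proper_faces P" for F
    using dim_normals[OF that] by (simp add: spherical_dim_def)
  have equiv: "voronoi_equivalent A A'"
    if "finite A'" "A' \<subseteq> sphere 0 1" "\<not> (\<exists>w c. w \<noteq> 0 \<and> A' \<subseteq> {x. w \<bullet> x = c})"
      "combinatorially_equivalent P (convex hull A')" for A' :: "'a set"
    using that assms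
    by (intro voronoi_equivalent_if_combinatorially_equivalent spherical_configuration.intro)
  show ?thesis
  proof (intro conjI ballI allI impI)
    show "voronoi_equivalent A A'"
      if "finite A' \<and> A' \<subseteq> sphere 0 1 \<and> \<not> (\<exists>w c. w \<noteq> 0 \<and> A' \<subseteq> {x. w \<bullet> x = c}) \<and>
        combinatorially_equivalent P (convex hull A')" for A' :: "'a set"
      using that by (elim conjE) (rule equiv)
  qed (fact antiisomorphism_normals voronoi_diagram_faces_eq[symmetric] dims singleton_proper_face
      closure_voronoi_domain_eq_normals[symmetric] voronoi_cell_vertices voronoi_vertices_eq)+
qed

end
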